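(* Let $X=\omega^{\le\omega}/\omega^\omega$ be the quotient space of the space $\omega^{\le\omega}$ obtained by collapsing its closed nowhere dense subset $\omega^\omega$ to a point. Then the function spaces $C_p(X)$, $C_k(X)$ and $C_{\downarrow\mathsf F}(X)$ are not Suslin.
   Context: Let $\omega^{<\omega}=\bigcup_{n\in\omega}\omega^n$ be the set of all functions $x:n\to\omega$ defined on finite ordinals $n\in\omega$, and let $\omega^{\le\omega}=\omega^{<\omega}\cup\omega^\omega$. For $x\in\omega^{\le\omega}$ with domain $n\le\omega$ and an ordinal $k\le\omega$, $x{\restriction}k$ is the restriction of $x$ to $\min\{n,k\}$. The set $\omega^{\le\omega}$ is partially ordered by $x\le y$ iff $x=y{\restriction}n$ for some ordinal $n\le\omega$. The topology of $\omega^{\le\omega}$: it is a Polish topology in which $\omega^{<\omega}$ is a dense subspace all of whose points are isolated in $\omega^{\le\omega}$, $\omega^\omega$ is a closed nowhere dense subset, and each $z\in\omega^\omega$ has the neighborhood base $\{{\uparrow}(z{\restriction}n):n\in\omega\}$, where ${\uparrow}x=\{y\in\omega^{\le\omega}:x\le y\}$. Equivalently, it is generated by the countable base consisting of the sets ${\uparrow}x$ and the singletons $\{x\}$, $x\in\omega^{<\omega}$. $X$ carries the quotient topology. Let $C(X)$ be the set of continuous real-valued functions on $X$. - $C_p(X)$ is $C(X)$ with the topology of pointwise convergence. - $C_k(X)$ is $C(X)$ with the compact-open topology, generated by the subbase of sets $\{f\in C(X):\min f(K)>r\}$ and $\{f\in C(X):\max f(K)<r\}$, where $K\subset X$ is nonempty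 compact and $r\in\mathbb{R}$. - $C_{\downarrow\mathsf F}(X)$ is $C(X)$ with the Fell hypograph topology, generated by the subbase of sets $\{f\in C(X):\max f(K)<r\}$ and $\{f\in C(X):\sup f(U)>r\}$, where $K\subset X$ is nonempty compact, $U\subset X$ is nonempty open, and $r\in\mathbb{R}$. A topological space is Polish if it is homeomorphic to a separable complete metric space; it is Suslin if it is the image of a Polish space under a continuous map. *)

theory Defs
  imports "HOL-Analysis.Analysis"
begin

section \<open>Polish and Suslin spaces\<close>

definition Polish_space :: "'a topology \<Rightarrow> bool" where
  "Polish_space P \<longleftrightarrow> completely_metrizable_space P \<and> separable_space P"

text \<open>A formula cannot quantify existentially over types, so the type carrying the Polish space is
  a parameter. Leaving it as a free type variable in a theorem asserting \<open>\<not> Suslin_space TYPE('b) Y\<close>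
  excludes Polish spaces carried by any type whatsoever.\<close>

definition Suslin_space :: "'b itself \<Rightarrow> 'a topology \<Rightarrow> bool" where
  "Suslin_space TYPE('b) Y \<longleftrightarrow>
     (\<exists>(P :: 'b topology) f. Polish_space P \<and> continuous_map P Y f \<and> f ` topspace P = topspace Y)"


section \<open>Finite and infinite sequences of natural numbers\<close>

text \<open>A function whose domain is an ordinal \<open>n \<le> \<omega>\<close> is a partial function on the natural numbers;
  the ordinals \<open>\<le> \<omega>\<close> are the elements of \<^typ>\<open>enat\<close>.\<close>

type_synonym natseq = "nat \<rightharpoonup> nat"

definition fin_seqs :: "natseq set" where
  "fin_seqs = {x. \<exists>n::nat. dom x = {..<n}}"

definition inf_seqs :: "natseq set" where
  "inf_seqs = {x. dom x = UNIV}"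

definition seqs :: "natseq set" where
  "seqs = fin_seqs \<union> inf_seqs"

definition seq_restrict :: "natseq \<Rightarrow> enat \<Rightarrow> natseq" where
  "seq_restrict x k = x |` {i. enat i < k}"

definition seq_le :: "natseq \<Rightarrow> natseq \<Rightarrow> bool" where
  "seq_le x y \<longleftrightarrow> (\<exists>n::enat. x = seq_restrict y n)"

definition upset :: "natseq \<Rightarrow> natseq set" where
  "upset x = {y \<in> seqs. seq_le x y}"

definition seq_topology :: "natseq topology" where
  "seq_topology = topology_generated_by (upset ` fin_seqs \<union> (\<lambda>x. {x}) ` fin_seqs)"

lemma topspace_seq_topology: "topspace seq_topology = seqs"
proof -
  have "Map.empty \<in> fin_seqs"
    by (auto simp: fin_seqs_def intro: exI[of _ 0])
  moreover have "upset Map.empty = seqs"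
  proof -
    have "Map.empty = seq_restrict y 0" for y
      by (simp add: seq_restrict_def)
    then have "seq_le Map.empty y" for y
      unfolding seq_le_def by blast
    then show ?thesis
      by (simp add: upset_def)
  qed
  ultimately show ?thesis
    unfolding seq_topology_def topology_generated_by_topspace
    by (auto simp: upset_def seqs_def)
qed


section \<open>Quotient spaces\<close>

definition quotient_topology :: "'a topology \<Rightarrow> ('a \<Rightarrow> 'b) \<Rightarrow> 'b topology" where
  "quotient_topology T q =
     topology (\<lambda>U. U \<subseteq> q ` topspace T \<and> openin T {x \<in> topspace T. q x \<in> U})"

lemma openin_quotient_topology:
  "openin (quotient_topology T q) U \<longleftrightarrow>
     U \<subseteq> q ` topspace T \<and> openin T {x \<in> topspace T. q x \<in> U}"
proof -
  have "istopology (\<lambda>U. U \<subseteq> q ` topspace T \<and> openin T {x \<in> topspace T. q x \<in> U})"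
    unfolding istopology_def
  proof (rule conjI; intro allI impI conjI)
    fix U V
    assume U: "U \<subseteq> q ` topspace T \<and> openin T {x \<in> topspace T. q x \<in> U}"
      and V: "V \<subseteq> q ` topspace T \<and> openin T {x \<in> topspace T. q x \<in> V}"
    show "U \<inter> V \<subseteq> q ` topspace T" using U by blast
    have "{x \<in> topspace T. q x \<in> U \<inter> V} =
        {x \<in> topspace T. q x \<in> U} \<inter> {x \<in> topspace T. q x \<in> V}" by blast
    then show "openin T {x \<in> topspace T. q x \<in> U \<inter> V}" using U V by auto
  next
    fix \<K>
    assume K: "\<forall>K\<in>\<K>. K \<subseteq> q ` topspace T \<and> openin T {x \<in> topspace T. q x \<in> K}"
    show "\<Union> \<K> \<subseteq> q ` topspace T" using K by blast
    have "{x \<in> topspace T. q x \<in> \<Union> \<K>} = (\<Union>K\<in>\<K>. {x \<in> topspace T. q x \<in> K})" by blast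
    then show "openin T {x \<in> topspace T. q x \<in> \<Union> \<K>}" using K by auto
  qed
  then show ?thesis by (simp add: quotient_topology_def)
qed

lemma topspace_quotient_topology: "topspace (quotient_topology T q) = q ` topspace T"
proof
  have "{x \<in> topspace T. q x \<in> q ` topspace T} = topspace T" by blast
  then have "openin (quotient_topology T q) (q ` topspace T)"
    by (simp add: openin_quotient_topology)
  then show "q ` topspace T \<subseteq> topspace (quotient_topology T q)" by (rule openin_subset)
  show "topspace (quotient_topology T q) \<subseteq> q ` topspace T"
    by (rule conjunct1[OF iffD1[OF openin_quotient_topology openin_topspace]])
qed

lemma quotient_map_quotient_topology: "quotient_map T (quotient_topology T q) q"
  by (simp add: quotient_map_def topspace_quotient_topology openin_quotient_topology)

text \<open>The points of the quotient are the equivalence classes: the set \<open>A\<close> itself and the singletons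
  of the points outside \<open>A\<close>.\<close>

definition collapse_map :: "'a set \<Rightarrow> 'a \<Rightarrow> 'a set" where
  "collapse_map A x = (if x \<in> A then A else {x})"

definition collapse_topology :: "'a topology \<Rightarrow> 'a set \<Rightarrow> 'a set topology" where
  "collapse_topology T A = quotient_topology T (collapse_map A)"

definition collapsed_seq_space :: "natseq set topology" where
  "collapsed_seq_space = collapse_topology seq_topology inf_seqs"


section \<open>Function spaces\<close>

text \<open>Functions on \<open>topspace X\<close> are represented by their extensional representatives, which are
  \<^const>\<open>undefined\<close> outside \<open>topspace X\<close>.\<close>

definition cont_funs :: "'a topology \<Rightarrow> ('a \<Rightarrow> real) set" where
  "cont_funs X = {f \<in> extensional (topspace X). continuous_map X euclideanreal f}"

definition Cp_topology :: "'a topology \<Rightarrow> ('a \<Rightarrow> real) topology" where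
  "Cp_topology X = subtopology (product_topology (\<lambda>_. euclideanreal) (topspace X)) (cont_funs X)"

text \<open>In the two subbases below, a continuous function attains its infimum and supremum on a
  nonempty compact set, so \<open>Inf (f ` K)\<close> and \<open>Sup (f ` K)\<close> are the minimum and maximum. On an open
  set a continuous function may be unbounded, so that supremum is taken in the extended reals.
  The whole set \<open>cont_funs X\<close> (the empty intersection) is listed among the generators because
  \<^const>\<open>topology_generated_by\<close> only takes nonempty intersections.\<close>

definition Ck_topology :: "'a topology \<Rightarrow> ('a \<Rightarrow> real) topology" where
  "Ck_topology X = topology_generated_by
     ({cont_funs X}
      \<union> {{f \<in> cont_funs X. Inf (f ` K) > r} | K r. compactin X K \<and> K \<noteq> {}}
      \<union> {{f \<in> cont_funs X. Sup (f ` K) < r} | K r. compactin X K \<and> K \<noteq> {}})"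

definition Fell_hypograph_topology :: "'a topology \<Rightarrow> ('a \<Rightarrow> real) topology" where
  "Fell_hypograph_topology X = topology_generated_by
     ({cont_funs X}
      \<union> {{f \<in> cont_funs X. Sup (f ` K) < r} | K r. compactin X K \<and> K \<noteq> {}}
      \<union> {{f \<in> cont_funs X. (SUP x\<in>U. ereal (f x)) > ereal r} | U r. openin X U \<and> U \<noteq> {}})"

lemma topspace_Cp_topology: "topspace (Cp_topology X) = cont_funs X"
  by (auto simp: Cp_topology_def cont_funs_def PiE_def)

lemma topspace_Ck_topology: "topspace (Ck_topology X) = cont_funs X"
  by (auto simp: Ck_topology_def)

lemma topspace_Fell_hypograph_topology: "topspace (Fell_hypograph_topology X) = cont_funs X"
  by (auto simp: Fell_hypograph_topology_def)

end

theory Submission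
  imports Defs
begin

text \<open>
  The continuous functions on the collapsed space encode the well-founded trees: the point at
  infinity is approached along every infinite branch, so the values of a continuous function
  converge along every branch, whereas a function supported on a well-founded tree vanishes near
  infinity. Marking only the nodes of even length of a tree makes the values along an infinite
  branch of the tree alternate between 1 and 0, so the marking extends continuously to infinity if
  and only if the tree is well-founded (lemmas \<open>infinite_branch_discontinuous\<close> and
  \<open>wellfounded_tree_continuous\<close>). As the set of well-founded trees is not analytic, it is to be
  expected that no Polish space maps onto the continuous functions in such a way that the values at
  the isolated points depend continuously on the argument.

  This is lemma \<open>no_surjection_continuous_at_isolated_points\<close>, whose proof replaces the
  theory of analytic sets by one diagonal tree. Given such a map \<open>F\<close> on a complete metric space
  with a dense sequence \<open>e\<close>, let a node \<open>x\<close> of length \<open>n\<close> belong to the tree \<open>T\<close> if some point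
  \<open>p\<close> has distance less than \<open>1/2^i\<close> from \<open>e (x i)\<close> for every \<open>i < n\<close>, and \<open>F p\<close> agrees with the
  marking of \<open>T\<close> at all nodes shorter than \<open>n\<close>. The definition refers to \<open>T\<close> on shorter nodes only,
  so it is a legitimate recursion. If some \<open>F p\<close> is the marking of \<open>T\<close>, then the indices
  of elements of \<open>e\<close> close to \<open>p\<close> form an infinite branch of \<open>T\<close>, which makes \<open>F p\<close> discontinuous.
  Hence no \<open>F p\<close> is the marking of \<open>T\<close>. But if \<open>T\<close> is well-founded, then its marking is continuous
  and therefore of the form \<open>F p\<close>, and if \<open>T\<close> has an infinite branch, then completeness yields a
  limit of the points witnessing its nodes, and \<open>F\<close> sends this limit to the marking of \<open>T\<close>.

  In all three function spaces, evaluation at an isolated point \<open>p\<close> is continuous, since \<open>{p}\<close> is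
  both compact and open. The diagonal argument compares functions at isolated points alone because
  evaluation at infinity need not be continuous in the Fell hypograph topology.
\<close>

section \<open>Initial segments\<close>

abbreviation init :: "natseq \<Rightarrow> nat \<Rightarrow> natseq" where
  "init z n \<equiv> seq_restrict z (enat n)"

abbreviation len :: "natseq \<Rightarrow> nat" where
  "len x \<equiv> card (dom x)"

lemma init_apply: "init z n i = (if i < n then z i else None)"
  by (simp add: seq_restrict_def restrict_map_def)

lemma init_init: "init (init z n) m = init z (min m n)"
  by (auto simp: init_apply fun_eq_iff)

lemma dom_init: "dom (init z n) = dom z \<inter> {..<n}"
  by (auto simp: init_apply split: if_splits)

lemma dom_init_inf: "z \<in> inf_seqs \<Longrightarrow> dom (init z n) = {..<n}"
  by (simp add: dom_init inf_seqs_def)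

lemma len_init_inf: "z \<in> inf_seqs \<Longrightarrow> len (init z n) = n"
  by (simp add: dom_init_inf)

lemma init_inf_in_fin: "z \<in> inf_seqs \<Longrightarrow> init z n \<in> fin_seqs"
  using dom_init_inf by (auto simp: fin_seqs_def)

lemma fin_not_inf: "x \<in> fin_seqs \<Longrightarrow> x \<notin> inf_seqs"
  by (auto simp: fin_seqs_def inf_seqs_def) (metis lessThan_iff less_irrefl UNIV_I)

lemma seq_restrict_infinity: "seq_restrict y \<infinity> = y"
  by (simp add: seq_restrict_def restrict_map_def)

lemma seq_le_init: "seq_le (init z n) y \<longleftrightarrow> (\<exists>m. init z n = init y m) \<or> init z n = y"
  unfolding seq_le_def by (metis enat.exhaust seq_restrict_infinity)

text \<open>With both sides cut at the same length, membership in a basic neighbourhood is an equation, and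
  the nesting of these neighbourhoods follows from \<open>init_init\<close>.\<close>

lemma upset_init_iff:
  assumes z: "z \<in> inf_seqs"
  shows "y \<in> upset (init z n) \<longleftrightarrow> y \<in> seqs \<and> init y n = init z n"
proof -
  have "init y n = init z n" if eq: "init z n = init y m" for m
  proof -
    have "{..<n} = dom y \<inter> {..<m}" using dom_init_inf[OF z, of n] eq by (simp add: dom_init)
    then have "i < m" if "i < n" for i using that by blast
    moreover have "init z n i = init y m i" for i using eq by simp
    ultimately show ?thesis by (auto simp: init_apply fun_eq_iff) (metis)
  qed
  moreover have "init y n = init z n" if "init z n = y"
    using that by (metis init_init min.idem)
  ultimately show ?thesis
    unfolding upset_def mem_Collect_eq seq_le_init by metis
qed

section \<open>The collapsed space\<close>

lemma openin_seq_upset: "x \<in> fin_seqs \<Longrightarrow> openin seq_topology (upset x)"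
  unfolding seq_topology_def by (rule topology_generated_by_Basis) blast

lemma openin_seq_singleton: "x \<in> fin_seqs \<Longrightarrow> openin seq_topology {x}"
  unfolding seq_topology_def by (rule topology_generated_by_Basis) blast

text \<open>The given generators are a subbase; the upper sets among them that contain a fixed infinite
  sequence form a chain, so finite intersections produce no smaller neighbourhoods of it.\<close>

lemma open_contains_upset:
  assumes "openin seq_topology U" "z \<in> U" "z \<in> inf_seqs"
  shows "\<exists>n. upset (init z n) \<subseteq> U"
proof -
  have "generate_topology_on (upset ` fin_seqs \<union> (\<lambda>x. {x}) ` fin_seqs) U"
    using assms(1) by (simp add: seq_topology_def openin_topology_generated_by_iff)
  then show ?thesis using assms(2)
  proof induction
    case (Int a b)
    then obtain n m where nm: "upset (init z n) \<subseteq> a" "upset (init z m) \<subseteq> b" by blast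
    have "upset (init z (max n m)) \<subseteq> upset (init z k)" if k: "k \<le> max n m" for k
    proof
      fix y assume "y \<in> upset (init z (max n m))"
      then have y: "y \<in> seqs" "init y (max n m) = init z (max n m)"
        by (simp_all add: upset_init_iff assms(3))
      have "init (init y (max n m)) k = init (init z (max n m)) k" using y(2) by simp
      then show "y \<in> upset (init z k)"
        using y(1) k by (simp add: upset_init_iff assms(3) init_init min_absorb1)
    qed
    then have "upset (init z (max n m)) \<subseteq> a \<inter> b"
      using nm by (meson Int_subset_iff max.cobounded1 max.cobounded2 order_trans)
    then show ?case by blast
  next
    case (UN K)
    then show ?case by (metis Union_iff Union_upper order_trans)
  next
    case (Basis s)
    then consider x where "x \<in> fin_seqs" "s = upset x" | "z \<in> fin_seqs" by blast
    then show ?case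
    proof cases
      case 1
      then have "seq_le x z" using Basis by (simp add: upset_def)
      moreover have "x \<noteq> z" using 1 assms(3) fin_not_inf by blast
      ultimately obtain n where "x = init z n"
        unfolding seq_le_def by (metis enat.exhaust seq_restrict_infinity)
      then show ?thesis using 1 by blast
    next
      case 2
      then show ?thesis using assms(3) fin_not_inf by blast
    qed
  qed simp
qed

lemma limitin_init:
  assumes z: "z \<in> inf_seqs"
  shows "limitin seq_topology (init z) z sequentially"
  unfolding limitin_sequentially
proof (intro conjI allI impI)
  show "z \<in> topspace seq_topology" using z by (simp add: topspace_seq_topology seqs_def)
  fix U assume "openin seq_topology U \<and> z \<in> U"
  then obtain N where N: "upset (init z N) \<subseteq> U" using open_contains_upset z by blast
  have "init z n \<in> upset (init z N)" if "N \<le> n" for n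
    using that init_inf_in_fin[OF z]
    by (simp add: upset_init_iff z init_init seqs_def min_absorb1)
  then show "\<exists>N. \<forall>n. N \<le> n \<longrightarrow> init z n \<in> U" using N by blast
qed

lemma collapse_fin: "x \<in> fin_seqs \<Longrightarrow> collapse_map inf_seqs x = {x}"
  by (simp add: collapse_map_def fin_not_inf)

lemma quotient_map_collapsed:
  "quotient_map seq_topology collapsed_seq_space (collapse_map inf_seqs)"
  by (simp add: collapsed_seq_space_def collapse_topology_def quotient_map_quotient_topology)

lemma topspace_collapsed: "topspace collapsed_seq_space = collapse_map inf_seqs ` seqs"
  by (simp add: collapsed_seq_space_def collapse_topology_def topspace_quotient_topology
      topspace_seq_topology)

lemma singleton_in_collapsed: "x \<in> fin_seqs \<Longrightarrow> {x} \<in> topspace collapsed_seq_space"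
  unfolding topspace_collapsed using collapse_fin by (force simp: seqs_def)

lemma isolated_in_collapsed:
  assumes x: "x \<in> fin_seqs"
  shows "openin collapsed_seq_space {{x}}"
proof -
  have "collapse_map inf_seqs y = {x} \<longleftrightarrow> y = x" for y
    using x fin_not_inf by (auto simp: collapse_map_def)
  then have "{y \<in> topspace seq_topology. collapse_map inf_seqs y \<in> {{x}}} = {x}"
    using x by (auto simp: topspace_seq_topology seqs_def)
  then show ?thesis
    using x singleton_in_collapsed[OF x] openin_seq_singleton
    unfolding collapsed_seq_space_def collapse_topology_def openin_quotient_topology
      topspace_quotient_topology by simp
qed

lemma cont_fun_converges_along_branch:
  assumes f: "f \<in> cont_funs collapsed_seq_space" and z: "z \<in> inf_seqs"
  shows "(\<lambda>n. f {init z n}) \<longlonglongrightarrow> f inf_seqs"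
proof -
  have "continuous_map seq_topology euclideanreal (f \<circ> collapse_map inf_seqs)"
    using f continuous_compose_quotient_map_eq[OF quotient_map_collapsed]
    by (auto simp: cont_funs_def)
  from continuous_map_limit[OF this limitin_init[OF z]]
  show ?thesis
    using z by (simp add: comp_def collapse_fin init_inf_in_fin limitin_canonical_iff)
      (simp add: collapse_map_def)
qed

text \<open>The parity excludes continuity with an arbitrary value at infinity: the plain indicator of the
  full tree would extend continuously by the value 1, although that tree has infinite branches.\<close>

definition parity_indicator :: "(natseq \<Rightarrow> bool) \<Rightarrow> natseq \<Rightarrow> real" where
  "parity_indicator T x = (if T x \<and> even (len x) then 1 else 0)"

text \<open>Along the branch the values alternate between 1 and 0, so they do not converge to the value at
  infinity.\<close>

lemma infinite_branch_discontinuous: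
  assumes f: "f \<in> cont_funs collapsed_seq_space" and z: "z \<in> inf_seqs"
    and branch: "\<And>n. T (init z n)"
    and eq: "\<And>x. x \<in> fin_seqs \<Longrightarrow> f {x} = parity_indicator T x"
  shows False
proof -
  have "f {init z n} = (if even n then 1 else 0)" for n
    using eq[OF init_inf_in_fin[OF z]] branch len_init_inf[OF z]
    by (simp add: parity_indicator_def)
  then have "(\<lambda>n. if even n then 1 else 0 :: real) \<longlonglongrightarrow> f inf_seqs"
    using cont_fun_converges_along_branch[OF f z] by simp
  from LIMSEQ_subseq_LIMSEQ[OF this, of "\<lambda>n. 2 * n"]
    LIMSEQ_subseq_LIMSEQ[OF this, of "\<lambda>n. 2 * n + 1"]
  have "f inf_seqs = 1" "f inf_seqs = 0"
    by (simp_all add: strict_mono_def comp_def LIMSEQ_const_iff)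
  then show False by simp
qed

text \<open>Every infinite sequence leaves the tree, and from then on all its extensions stay outside. So
  the function with value 0 at infinity is locally constant before collapsing, and continuity passes
  to the quotient.\<close>

lemma wellfounded_tree_continuous:
  assumes closed: "\<And>x n. x \<in> fin_seqs \<Longrightarrow> T x \<Longrightarrow> T (init x n)"
    and wf: "\<And>z. z \<in> inf_seqs \<Longrightarrow> \<exists>n. \<not> T (init z n)"
  obtains f where "f \<in> cont_funs collapsed_seq_space"
    and "\<And>x. x \<in> fin_seqs \<Longrightarrow> f {x} = parity_indicator T x"
proof -
  define f where "f = restrict (\<lambda>p. if p = inf_seqs then 0 else parity_indicator T (the_elem p))
    (topspace collapsed_seq_space)"
  have fin: "f {x} = parity_indicator T x" if x: "x \<in> fin_seqs" for x
    using singleton_in_collapsed[OF x] fin_not_inf[OF x] by (auto simp: f_def)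
  let ?g = "f \<circ> collapse_map inf_seqs"
  have g_fin: "?g x = parity_indicator T x" if "x \<in> fin_seqs" for x
    using that by (simp add: fin collapse_fin)
  have g_inf: "?g z = 0" if "z \<in> inf_seqs" for z
    using that topspace_collapsed by (force simp: f_def collapse_map_def seqs_def)
  have "continuous_map seq_topology euclideanreal ?g"
    unfolding continuous_map_def
  proof (intro conjI allI impI)
    fix V :: "real set"
    let ?W = "{x \<in> topspace seq_topology. ?g x \<in> V}"
    have "\<exists>N. openin seq_topology N \<and> x \<in> N \<and> N \<subseteq> ?W" if x: "x \<in> ?W" for x
    proof (cases "x \<in> fin_seqs")
      case True
      then show ?thesis using openin_seq_singleton x by blast
    next
      case False
      then have z: "x \<in> inf_seqs" using x by (simp add: topspace_seq_topology seqs_def)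
      then obtain n where n: "\<not> T (init x n)" using wf by blast
      have "?g y = 0" if y: "y \<in> upset (init x n)" for y
      proof (cases "y \<in> fin_seqs")
        case True
        then have "\<not> T y" using n closed y by (metis upset_init_iff[OF z])
        then show ?thesis using g_fin[OF True] by (simp add: parity_indicator_def)
      next
        case False
        then show ?thesis using y g_inf by (simp add: upset_def seqs_def)
      qed
      then have "upset (init x n) \<subseteq> ?W"
        using x g_inf[OF z] by (auto simp: topspace_seq_topology upset_def)
      moreover have "x \<in> upset (init x n)"
        using z by (simp add: upset_init_iff seqs_def)
      ultimately show ?thesis using openin_seq_upset init_inf_in_fin[OF z] by blast
    qed
    then show "openin seq_topology ?W" by (subst openin_subopen) blast
  qed simp
  moreover have "f \<in> extensional (topspace collapsed_seq_space)"
    unfolding f_def by (rule restrict_extensional)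
  ultimately have "f \<in> cont_funs collapsed_seq_space"
    using continuous_compose_quotient_map_eq[OF quotient_map_collapsed]
    by (auto simp: cont_funs_def)
  then show ?thesis using fin that by blast
qed

section \<open>The diagonal tree\<close>

lemma (in Metric_space) separable_dense_sequence:
  assumes sep: "separable_space mtopology" and "M \<noteq> {}"
  shows "\<exists>e :: nat \<Rightarrow> 'a. range e \<subseteq> M \<and> (\<forall>p\<in>M. \<forall>r>0. \<exists>k. d p (e k) < r)"
proof -
  obtain C where C: "countable C" "C \<subseteq> M" "mtopology closure_of C = topspace mtopology"
    using sep by (auto simp: separable_space_def)
  have near: "\<exists>c\<in>C. d p c < r" if "p \<in> M" "0 < r" for p r
  proof -
    have "C \<inter> mball p r \<noteq> {}"
      using C(3)[unfolded dense_intersects_open] that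
      by (metis centre_in_mball_iff empty_iff openin_mball)
    then show ?thesis by auto
  qed
  then have "C \<noteq> {}" using \<open>M \<noteq> {}\<close> by (metis all_not_in_conv zero_less_one)
  then have "range (from_nat_into C) = C" using C(1) by (rule range_from_nat_into)
  then show ?thesis using near C(2) by (metis rangeE)
qed

lemma (in Metric_space) shrinking_balls_MCauchy:
  assumes e: "range e \<subseteq> M" and p: "range p \<subseteq> M"
    and near: "\<And>n i. i < n \<Longrightarrow> d (p n) (e i) < (1/2)^i"
  shows "MCauchy p"
  unfolding MCauchy_def
proof (intro conjI allI impI p)
  fix \<epsilon> :: real assume "0 < \<epsilon>"
  then obtain i where i: "(1/2)^i < \<epsilon>/2"
    using real_arch_pow_inv[of "\<epsilon>/2" "1/2"] by auto
  have "d (p n) (p m) < \<epsilon>" if nm: "Suc i \<le> n" "Suc i \<le> m" for n m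
  proof -
    have "d (p n) (p m) \<le> d (p n) (e i) + d (p m) (e i)"
      using e p triangle' by (metis range_subsetD triangle'')
    then show ?thesis using near[of i n] near[of i m] nm i by linarith
  qed
  then show "\<exists>N. \<forall>n m. N \<le> n \<longrightarrow> N \<le> m \<longrightarrow> d (p n) (p m) < \<epsilon>" by blast
qed

text \<open>A node codes approximations to a point \<open>p\<close>, and the diagonal tree consists of the codes of those
  \<open>p\<close> for which \<open>F p\<close> so far looks like the marking of that same tree. Either answer to the question
  whether this tree is well-founded produces a \<open>p\<close> for which \<open>F p\<close> is the marking, and such a \<open>p\<close>
  cannot exist.\<close>

lemma no_surjection_continuous_at_isolated_points:
  fixes P :: "'a topology"
  assumes P: "Polish_space P"
    and surj: "F ` topspace P = cont_funs collapsed_seq_space"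
    and eval: "\<And>x. x \<in> fin_seqs \<Longrightarrow> continuous_map P euclideanreal (\<lambda>p. F p {x})"
  shows False
proof -
  obtain M d where M: "Metric_space M d" and comp: "Metric_space.mcomplete M d"
    and P_eq: "P = Metric_space.mtopology M d"
    using P by (auto simp: Polish_space_def completely_metrizable_space_def)
  interpret Metric_space M d by (rule M)
  have top: "topspace P = M" by (simp add: P_eq)
  obtain f0 where "f0 \<in> cont_funs collapsed_seq_space"
    by (rule wellfounded_tree_continuous[of "\<lambda>_. False"]) auto
  then have ne: "M \<noteq> {}" using surj top by auto
  have sep: "separable_space mtopology" using P P_eq by (simp add: Polish_space_def)
  obtain e :: "nat \<Rightarrow> 'a" where e: "range e \<subseteq> M"
    and dense: "\<And>p r. p \<in> M \<Longrightarrow> 0 < r \<Longrightarrow> \<exists>k. d p (e k) < r"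
    using separable_dense_sequence[OF sep ne] by metis
  \<comment> \<open>The diagonal tree is the fixed point of \<open>H\<close>; the strict inequality between lengths makes the
    recursion well-founded.\<close>
  define H where "H = (\<lambda>T x. \<exists>p\<in>M. (\<forall>i < len x. d p (e (the (x i))) < (1/2)^i) \<and>
    (\<forall>y\<in>fin_seqs. len y < len x \<longrightarrow> F p {y} = parity_indicator T y))"
  define T where "T = wfrec (Wellfounded.measure len) H"
  have "adm_wf (Wellfounded.measure len) H"
    by (auto simp: adm_wf_def H_def parity_indicator_def)
  then have T: "T = H T"
    unfolding T_def by (intro wfrec_fixpoint wf_measure)
  have closed: "T (init x n)" if x: "x \<in> fin_seqs" "T x" for x n
  proof -
    have "len (init x n) \<le> len x"
      using x(1) by (auto simp: fin_seqs_def dom_init intro!: card_mono)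
    moreover have "i < n" if "i < len (init x n)" for i
      using that card_mono[of "{..<n}" "dom (init x n)"] by (simp add: dom_init)
    moreover obtain p where "p \<in> M" "\<forall>i < len x. d p (e (the (x i))) < (1/2)^i"
      "\<forall>y\<in>fin_seqs. len y < len x \<longrightarrow> F p {y} = parity_indicator T y"
      using x(2) by (subst (asm) T) (auto simp: H_def)
    ultimately have "H T (init x n)"
      unfolding H_def by (intro bexI[of _ p]) (auto simp: init_apply)
    then show ?thesis using T by metis
  qed
  have no_code: False if p: "p \<in> M" and Fp: "\<And>x. x \<in> fin_seqs \<Longrightarrow> F p {x} = parity_indicator T x"
    for p
  proof -
    have "\<forall>i. \<exists>k. d p (e k) < (1/2)^i" using dense p by simp
    then obtain k where k: "\<And>i. d p (e (k i)) < (1/2)^i" by metis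
    define z where "z = (\<lambda>i. Some (k i))"
    have z: "z \<in> inf_seqs" by (auto simp: z_def inf_seqs_def)
    have "H T (init z n)" for n
      unfolding H_def len_init_inf[OF z]
      using p k Fp by (intro bexI[of _ p]) (simp_all add: init_apply z_def)
    then have "T (init z n)" for n using T by metis
    then show False
      using infinite_branch_discontinuous[of "F p" z T] surj top p z Fp by blast
  qed
  show False
  proof (cases "\<exists>z\<in>inf_seqs. \<forall>n. T (init z n)")
    case False
    then obtain f where f: "f \<in> cont_funs collapsed_seq_space"
      and feq: "\<And>x. x \<in> fin_seqs \<Longrightarrow> f {x} = parity_indicator T x"
      using wellfounded_tree_continuous closed by metis
    then show False using no_code surj top by (metis imageE)
  next
    case True
    then obtain z where z: "z \<in> inf_seqs" and Tz: "\<And>n. T (init z n)" by blast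
    have "H T (init z n)" for n using Tz T by metis
    then have "\<forall>n. \<exists>p\<in>M. (\<forall>i < n. d p (e (the (z i))) < (1/2)^i) \<and>
       (\<forall>y\<in>fin_seqs. len y < n \<longrightarrow> F p {y} = parity_indicator T y)"
      unfolding H_def len_init_inf[OF z] by (simp add: init_apply)
    then obtain p where p: "\<And>n. p n \<in> M"
      and near: "\<And>n i. i < n \<Longrightarrow> d (p n) (e (the (z i))) < (1/2)^i"
      and Fp: "\<And>n y. y \<in> fin_seqs \<Longrightarrow> len y < n \<Longrightarrow> F (p n) {y} = parity_indicator T y"
      by metis
    have "MCauchy p"
      using e p near by (intro shrinking_balls_MCauchy[of "\<lambda>i. e (the (z i))"]) auto
    then obtain q where q: "limitin P p q sequentially"
      using comp by (auto simp: mcomplete_def P_eq)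
    then have "q \<in> M" using top limitin_topspace by fastforce
    moreover have "F q {x} = parity_indicator T x" if x: "x \<in> fin_seqs" for x
    proof (rule LIMSEQ_unique)
      show "(\<lambda>n. F (p n) {x}) \<longlonglongrightarrow> F q {x}"
        using continuous_map_limit[OF eval[OF x] q] by (simp add: comp_def limitin_canonical_iff)
      have "\<forall>\<^sub>F n in sequentially. F (p n) {x} = parity_indicator T x"
        using eventually_gt_at_top[of "len x"] by eventually_elim (rule Fp[OF x])
      then show "(\<lambda>n. F (p n) {x}) \<longlonglongrightarrow> parity_indicator T x"
        by (rule tendsto_eventually)
    qed
    ultimately show False by (rule no_code)
  qed
qed

section \<open>The three function spaces\<close>

lemma not_Suslin_if_evaluations_continuous:
  assumes top: "topspace Y = cont_funs collapsed_seq_space"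
    and eval: "\<And>x. x \<in> fin_seqs \<Longrightarrow> continuous_map Y euclideanreal (\<lambda>f. f {x})"
  shows "\<not> Suslin_space TYPE('b) Y"
proof
  assume "Suslin_space TYPE('b) Y"
  then obtain P :: "'b topology" and F
    where P: "Polish_space P" and F: "continuous_map P Y F" "F ` topspace P = topspace Y"
    by (auto simp: Suslin_space_def)
  show False
  proof (rule no_surjection_continuous_at_isolated_points[OF P])
    show "F ` topspace P = cont_funs collapsed_seq_space" using F(2) top by simp
    show "continuous_map P euclideanreal (\<lambda>p. F p {x})" if "x \<in> fin_seqs" for x
      using continuous_map_compose[OF F(1) eval[OF that]] by (simp add: comp_def)
  qed
qed

lemma Cp_evaluation_continuous:
  "p \<in> topspace X \<Longrightarrow> continuous_map (Cp_topology X) euclideanreal (\<lambda>f. f p)"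
  unfolding Cp_topology_def
  by (intro continuous_map_from_subtopology continuous_map_product_projection)

lemma Ck_evaluation_continuous:
  assumes "p \<in> topspace X"
  shows "continuous_map (Ck_topology X) euclideanreal (\<lambda>f. f p)"
  unfolding continuous_map_upper_lower_semicontinuous_lt topspace_Ck_topology
proof (intro conjI allI)
  have K: "compactin X {p}" using assms by (simp add: finite_imp_compactin)
  show "openin (Ck_topology X) {f \<in> cont_funs X. f p > r}" for r
    unfolding Ck_topology_def
    using K by (intro topology_generated_by_Basis UnI1 UnI2 CollectI exI[of _ "{p}"] exI[of _ r]) auto
  show "openin (Ck_topology X) {f \<in> cont_funs X. f p < r}" for r
    unfolding Ck_topology_def
    using K by (intro topology_generated_by_Basis UnI2 CollectI exI[of _ "{p}"] exI[of _ r]) auto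
qed

text \<open>The generators bound suprema over open sets from below, so the lower bound on \<open>f p\<close> comes from
  the open set \<open>{p}\<close>.\<close>

lemma Fell_hypograph_evaluation_continuous:
  assumes "openin X {p}"
  shows "continuous_map (Fell_hypograph_topology X) euclideanreal (\<lambda>f. f p)"
  unfolding continuous_map_upper_lower_semicontinuous_lt topspace_Fell_hypograph_topology
proof (intro conjI allI)
  have K: "compactin X {p}" using openin_subset[OF assms] by (simp add: finite_imp_compactin)
  show "openin (Fell_hypograph_topology X) {f \<in> cont_funs X. f p > r}" for r
    unfolding Fell_hypograph_topology_def
    using assms by (intro topology_generated_by_Basis UnI2 CollectI exI[of _ "{p}"] exI[of _ r]) auto
  show "openin (Fell_hypograph_topology X) {f \<in> cont_funs X. f p < r}" for r
    unfolding Fell_hypograph_topology_def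
    using K by (intro topology_generated_by_Basis UnI1 UnI2 CollectI exI[of _ "{p}"] exI[of _ r]) auto
qed

theorem claim7p2:
  "\<not> Suslin_space TYPE('b) (Cp_topology collapsed_seq_space) \<and>
   \<not> Suslin_space TYPE('b) (Ck_topology collapsed_seq_space) \<and>
   \<not> Suslin_space TYPE('b) (Fell_hypograph_topology collapsed_seq_space)"
  by (intro conjI not_Suslin_if_evaluations_continuous topspace_Cp_topology topspace_Ck_topology
      topspace_Fell_hypograph_topology Cp_evaluation_continuous Ck_evaluation_continuous
      Fell_hypograph_evaluation_continuous singleton_in_collapsed isolated_in_collapsed)

end
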